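(* Let $t$ be a non-negative integer and let $G$ be a 2-connected finite simple graph with circumference $t$. Then the pathwidth of $G$ is at most $\lfloor \tfrac{t}{2}\rfloor (t-1)$.
   Context: The circumference of a graph is the length of a longest cycle in it (or $0$ if the graph is acyclic). A path decomposition of $G$ is a sequence $(B_1,\dots,B_n)$ of subsets of $V(G)$ such that every vertex lies in some bag, for each vertex $v$ the set of indices $i$ with $v\in B_i$ is an interval, and every edge has both endpoints in some common bag; its width is $\max_i |B_i|-1$. The pathwidth of $G$ is the minimum width of a path decomposition of $G$. *)

theory Defs
  imports "Graph_Theory.Graph_Theory"
begin

text \<open>
  A finite simple graph is a digraph satisfying the locale predicate \<open>graph\<close>: finite, loop-free,
  without parallel arcs and symmetric, so that an undirected edge \<open>uv\<close> is the pair of arcs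
  \<open>u \<rightarrow> v\<close> and \<open>v \<rightarrow> u\<close>.
\<close>

definition k_connected :: "nat \<Rightarrow> ('a, 'b) pre_digraph \<Rightarrow> bool" where
  "k_connected k G \<longleftrightarrow> k < card (verts G) \<and>
     (\<forall>X \<subseteq> verts G. card X < k \<longrightarrow> Digraph_Component.connected (G \<restriction> (verts G - X)))"

text \<open>
  The predicate \<open>pre_digraph.cycle\<close> also accepts the closed walks \<open>u \<rightarrow> v \<rightarrow> u\<close> along a single
  edge. In a simple graph the cycles are those of length at least 3.
\<close>

definition cycle_lengths :: "('a, 'b) pre_digraph \<Rightarrow> nat set" where
  "cycle_lengths G = {length p | p. pre_digraph.cycle G p \<and> 3 \<le> length p}"

definition circumference :: "('a, 'b) pre_digraph \<Rightarrow> nat" where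
  "circumference G = (if cycle_lengths G = {} then 0 else Max (cycle_lengths G))"

definition path_decomposition :: "('a, 'b) pre_digraph \<Rightarrow> 'a set list \<Rightarrow> bool" where
  "path_decomposition G Bs \<longleftrightarrow>
     Bs \<noteq> [] \<and>
     (\<forall>B \<in> set Bs. B \<subseteq> verts G) \<and>
     (\<forall>v \<in> verts G. \<exists>B \<in> set Bs. v \<in> B) \<and>
     (\<forall>v \<in> verts G. \<exists>a b. {i. i < length Bs \<and> v \<in> Bs ! i} = {a..b}) \<and>
     (\<forall>(u, v) \<in> arcs_ends G. \<exists>B \<in> set Bs. u \<in> B \<and> v \<in> B)"

text \<open>
  The subtraction is on natural numbers. It truncates only if all bags are empty, hence only for
  the graph without vertices, which then gets width 0 instead of \<open>-1\<close>.
\<close>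

definition width :: "'a set list \<Rightarrow> nat" where
  "width Bs = Max (card ` set Bs) - 1"

definition pathwidth :: "('a, 'b) pre_digraph \<Rightarrow> nat" where
  "pathwidth G = (LEAST w. \<exists>Bs. path_decomposition G Bs \<and> width Bs = w)"

end

theory Submission
  imports Defs
begin

text \<open>
  A depth-first search forest of depth at most \<open>k\<close> yields a path decomposition with bags of size
  at most \<open>k\<close>, so it suffices to bound the length of a path \<open>P\<close>. By 2-connectedness some cycle
  \<open>C\<close>, of length \<open>c \<le> t\<close>, passes through both ends of \<open>P\<close>. A piece of \<open>P\<close> of length \<open>l\<close> between
  two consecutive visits to \<open>C\<close> closes up to a cycle with either arc of \<open>C\<close>, so \<open>2l \<le> 2t - c\<close>, with
  equality only if the two visits are antipodal on \<open>C\<close>. Two consecutive pieces cannot both attain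
  equality, hence their total length is at most \<open>2t - c - 1\<close>. As there are at most \<open>c - 1\<close> pieces,
  \<open>P\<close> has at most \<open>\<lfloor>t/2\<rfloor>(t - 1)\<close> edges.
\<close>

section \<open>Paths and cycles as vertex lists\<close>

definition simple_path :: "('a \<Rightarrow> 'a \<Rightarrow> bool) \<Rightarrow> 'a set \<Rightarrow> 'a list \<Rightarrow> bool" where
  "simple_path E S p \<longleftrightarrow> p \<noteq> [] \<and> distinct p \<and> successively E p \<and> set p \<subseteq> S"

definition simple_cycle :: "('a \<Rightarrow> 'a \<Rightarrow> bool) \<Rightarrow> 'a set \<Rightarrow> 'a list \<Rightarrow> bool" where
  "simple_cycle E S p \<longleftrightarrow>
     3 \<le> length p \<and> distinct p \<and> successively E (p @ [hd p]) \<and> set p \<subseteq> S"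

lemma simple_path_mono: "simple_path E S p \<Longrightarrow> S \<subseteq> T \<Longrightarrow> simple_path E T p"
  by (auto simp: simple_path_def)

lemma simple_path_prefix: "simple_path E S (xs @ ys) \<Longrightarrow> xs \<noteq> [] \<Longrightarrow> simple_path E S xs"
  by (auto simp: simple_path_def successively_append_iff)

lemma simple_path_suffix: "simple_path E S (xs @ ys) \<Longrightarrow> ys \<noteq> [] \<Longrightarrow> simple_path E S ys"
  by (auto simp: simple_path_def successively_append_iff)

text \<open>If \<open>w\<close> already lies on \<open>p\<close>, the prefix of \<open>p\<close>
  ending at \<open>w\<close> serves. Hence the set of vertices joined to a fixed start by simple
  paths is closed under \<open>E\<close>.\<close>

lemma simple_path_extend:
  assumes p: "simple_path E S p" and E: "E (last p) w" and w: "w \<in> S"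
  shows "\<exists>q. simple_path E S q \<and> hd q = hd p \<and> last q = w"
proof (cases "w \<in> set p")
  case True
  then obtain xs ys where "p = xs @ w # ys" by (auto dest: split_list)
  then have "simple_path E S (xs @ [w])" "hd (xs @ [w]) = hd p"
    using p simple_path_prefix[of E S "xs @ [w]" ys] by (auto simp: hd_append)
  then show ?thesis by (intro exI[of _ "xs @ [w]"]) auto
next
  case False
  then show ?thesis
    using assms by (intro exI[of _ "p @ [w]"]) (auto simp: simple_path_def successively_append_iff)
qed

lemma successively_rev_symp: "symp E \<Longrightarrow> successively E (rev xs) \<longleftrightarrow> successively E xs"
proof -
  assume "symp E"
  then have "(\<lambda>x y. E y x) = E" by (auto simp: fun_eq_iff dest: sympD)
  then show ?thesis unfolding successively_rev by (rule arg_cong)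
qed

lemma simple_cycle_rotate: "simple_cycle E S (xs @ ys) \<Longrightarrow> simple_cycle E S (ys @ xs)"
  by (cases xs; cases ys)
    (auto simp: simple_cycle_def successively_append_iff successively_Cons hd_append split: if_splits)

lemma simple_cycle_rotate_to:
  assumes "simple_cycle E S C" "b \<in> set C"
  obtains r where "simple_cycle E S (b # r)" "set (b # r) = set C" "length (b # r) = length C"
proof -
  obtain xs ys where C: "C = xs @ b # ys" using assms(2) by (auto dest: split_list)
  then have "simple_cycle E S (b # ys @ xs)" using assms(1) simple_cycle_rotate[of E S xs "b # ys"] by simp
  with C show ?thesis by (intro that[of "ys @ xs"]) auto
qed

text \<open>The arc \<open>vs\<close> leading from \<open>a\<close> back to \<open>b\<close> is
  replaced by the reversal of \<open>q\<close>. If \<open>us\<close> and \<open>q\<close> were both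
  empty, only \<open>b\<close> and \<open>a\<close> would remain, which is no cycle.\<close>

lemma simple_cycle_detour:
  assumes sym: "symp E" and C: "simple_cycle E S (b # us @ a # vs)"
    and q: "successively E (b # q @ [a])" "distinct q" "set q \<subseteq> S"
      "set q \<inter> set (b # us @ a # vs) = {}" "us @ q \<noteq> []"
  shows "simple_cycle E S (b # us @ a # rev q)"
proof -
  have "successively E (rev (b # q @ [a]))" using q(1) sym by (simp only: successively_rev_symp)
  then have "successively E (a # rev q @ [b])" by simp
  moreover have "successively E (b # us @ [a])"
    using C by (auto simp: simple_cycle_def successively_append_iff successively_Cons hd_append
        split: if_splits)
  ultimately have "successively E ((b # us @ a # rev q) @ [b])"
    by (auto simp: successively_append_iff successively_Cons hd_append split: if_splits)
  moreover have "3 \<le> length (b # us @ a # rev q)" using q(5) by (cases us; cases q) auto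
  ultimately show ?thesis using C q by (auto simp: simple_cycle_def)
qed

section \<open>Two-connected relations\<close>

locale two_connected =
  fixes E :: "'a \<Rightarrow> 'a \<Rightarrow> bool" and V :: "'a set"
  assumes fin: "finite V" and card_V: "3 \<le> card V"
    and sym: "symp E" and irrefl: "\<not> E x x"
    and conn_del: "\<lbrakk>x \<in> V; u \<in> V - {x}; v \<in> V - {x}\<rbrakk> \<Longrightarrow>
      \<exists>p. simple_path E (V - {x}) p \<and> hd p = u \<and> last p = v"
begin

text \<open>A path from \<open>x\<close> to a third vertex avoiding \<open>y\<close> starts with a
  neighbour \<open>w\<close> of \<open>x\<close> other than \<open>y\<close>. A path from
  \<open>w\<close> to \<open>y\<close> avoiding \<open>x\<close> then closes up through
  \<open>x\<close>.\<close>

lemma ex_cycle_through_edge: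
  assumes "x \<in> V" "y \<in> V" "E x y"
  shows "\<exists>C. simple_cycle E V C \<and> x \<in> set C \<and> y \<in> set C"
proof -
  have xy: "x \<noteq> y" using assms irrefl by auto
  have "\<not> V \<subseteq> {x, y}"
  proof
    assume "V \<subseteq> {x, y}"
    then have "card V \<le> card {x, y}" by (intro card_mono) auto
    then show False using card_V xy by simp
  qed
  then obtain z where z: "z \<in> V" "z \<noteq> x" "z \<noteq> y" by auto
  obtain p where p: "simple_path E (V - {y}) p" "hd p = x" "last p = z"
    using conn_del[of y x z] assms xy z by auto
  then obtain w r where w: "p = x # w # r"
    using z by (cases p; cases "tl p") (auto simp: simple_path_def)
  with p have w': "E x w" "w \<in> V" "w \<noteq> y" "w \<noteq> x" by (auto simp: simple_path_def)
  obtain q where q: "simple_path E (V - {x}) q" "hd q = w" "last q = y"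
    using conn_del[of x w y] assms xy w' by auto
  then have "q \<noteq> []" by (simp add: simple_path_def)
  moreover have "2 \<le> length q"
    using q w' \<open>q \<noteq> []\<close> by (cases q; cases "tl q") auto
  moreover have "E y x" using assms sym by (auto dest: sympD)
  ultimately have "simple_cycle E V (x # q)"
    using q w' assms by (auto simp: simple_cycle_def simple_path_def successively_append_iff successively_Cons)
  moreover have "y \<in> set q" using q \<open>q \<noteq> []\<close> by auto
  ultimately show ?thesis by (intro exI[of _ "x # q"]) auto
qed

text \<open>If \<open>z\<close> is off the cycle, a path from \<open>z\<close> to \<open>x\<close>
  avoiding \<open>y\<close> is followed up to its first vertex \<open>w\<close> on the cycle.
  Together with the edge from \<open>y\<close> to \<open>z\<close> it is an ear from
  \<open>y\<close> to \<open>w\<close>, and it closes up with an arc of the cycle containing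
  \<open>x\<close>.\<close>

lemma cycle_through_neighbour:
  assumes C: "simple_cycle E V C" "x \<in> set C" "y \<in> set C" and "x \<noteq> y" "E y z" "z \<in> V"
  shows "\<exists>C. simple_cycle E V C \<and> x \<in> set C \<and> z \<in> set C"
proof (cases "z \<in> set C")
  case True
  then show ?thesis using C by blast
next
  case False
  have V: "x \<in> V" "y \<in> V" "z \<noteq> y" using C False by (auto simp: simple_cycle_def)
  then obtain p where p: "simple_path E (V - {y}) p" "hd p = z" "last p = x"
    using conn_del[of y z x] assms by auto
  then have "\<exists>w\<in>set p. w \<in> set C" using C(2) last_in_set[of p] by (auto simp: simple_path_def)
  then obtain q w r where s: "p = q @ w # r" "w \<in> set C" "\<forall>v\<in>set q. v \<notin> set C"
    using split_list_first_prop[of p "\<lambda>w. w \<in> set C"] by blast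
  with False p(2) have "q \<noteq> []" by auto
  with s p(2) have q: "q \<noteq> []" "hd q = z" by auto
  have zq: "z \<in> set q" using q by auto
  have wy: "w \<noteq> y" using p s by (auto simp: simple_path_def)
  obtain rs where rs: "simple_cycle E V (y # rs)" "set (y # rs) = set C"
    using simple_cycle_rotate_to[OF C(1,3)] .
  with s wy have "w \<in> set rs" by auto
  then obtain us vs where uv: "rs = us @ w # vs" by (auto dest: split_list)
  have cyc: "simple_cycle E V (y # us @ w # vs)" using rs uv by simp
  have sq: "successively E (y # q @ [w])" "successively E (q @ [w])"
    using p s q \<open>E y z\<close> by (auto simp: simple_path_def successively_append_iff successively_Cons)
  have dq: "distinct q" "set q \<subseteq> V" using p s by (auto simp: simple_path_def)
  have sC: "set C = insert y (set us \<union> insert w (set vs))" using rs uv by auto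
  then have dj: "set q \<inter> set (y # us @ w # vs) = {}" using s(3) by auto
  show ?thesis
  proof (cases "x \<in> set vs")
    case True
    \<comment> \<open>The arc \<open>vs\<close> has to survive, so the cycle is read from
      \<open>w\<close>, which puts \<open>vs\<close> in the place of \<open>us\<close>; the ear is
      reversed accordingly.\<close>
    have "simple_cycle E V (w # vs @ y # us)" using simple_cycle_rotate[of E V "y # us" "w # vs"] cyc by simp
    moreover have "successively E (w # rev q @ [y])"
    proof -
      have "successively E (rev (y # q @ [w]))" using sq(1) sym by (simp only: successively_rev_symp)
      then show ?thesis by simp
    qed
    ultimately have "simple_cycle E V (w # vs @ y # rev (rev q))"
      using dq dj q by (intro simple_cycle_detour[OF sym, where vs = us]) auto
    then show ?thesis using True zq by (intro exI[of _ "w # vs @ y # rev (rev q)"]) auto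
  next
    case False
    \<comment> \<open>Here \<open>x\<close> is \<open>w\<close> itself or lies on
      \<open>us\<close>.\<close>
    have "simple_cycle E V (y # us @ w # rev q)"
      using simple_cycle_detour[OF sym cyc sq(1) dq dj] q by simp
    then show ?thesis using False C(2) \<open>x \<noteq> y\<close> sC zq by (intro exI[of _ "y # us @ w # rev q"]) auto
  qed
qed

text \<open>Induction along the path: its first vertex stays fixed while
  \<open>cycle_through_neighbour\<close> moves the cycle from each vertex to the next. A single edge
  starts the induction.\<close>

lemma ex_cycle_through_ends:
  assumes "simple_path E V p" "2 \<le> length p"
  shows "\<exists>C. simple_cycle E V C \<and> hd p \<in> set C \<and> last p \<in> set C"
  using assms
proof (induction p rule: rev_induct)
  case Nil
  then show ?case by simp
next
  case (snoc z p)
  have "p \<noteq> []" using snoc.prems by auto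
  with snoc.prems have p: "simple_path E V p" "E (last p) z" "z \<in> V" "p \<noteq> []"
    by (auto simp: simple_path_def successively_append_iff)
  show ?case
  proof (cases "2 \<le> length p")
    case True
    then obtain C where C: "simple_cycle E V C" "hd p \<in> set C" "last p \<in> set C" using snoc.IH p by auto
    moreover have "hd p \<noteq> last p" using True p by (cases p) (auto simp: simple_path_def)
    ultimately show ?thesis using cycle_through_neighbour[OF C _ p(2,3)] p(4) by auto
  next
    case False
    then obtain x where "p = [x]" using p(4) by (cases p; cases "tl p") auto
    then show ?thesis using ex_cycle_through_edge[of x z] p by (auto simp: simple_path_def)
  qed
qed

end

section \<open>The length of a path in a graph of bounded circumference\<close>

locale two_connected_circumference = two_connected +
  fixes t :: nat
  assumes circ: "simple_cycle E V C \<Longrightarrow> length C \<le> t"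
begin

text \<open>The ear closes up to a cycle with either arc. The list \<open>q\<close> holds only its
  inner vertices and may be empty: the ear may be a chord or an edge of the cycle itself.\<close>

lemma ear_length:
  assumes C: "simple_cycle E V (b # us @ a # vs)"
    and q: "successively E (b # q @ [a])" "distinct q" "set q \<subseteq> V"
      "set q \<inter> set (b # us @ a # vs) = {}"
  shows "length us + length q + 2 \<le> t" "length vs + length q + 2 \<le> t"
proof -
  have *: "length us + length q + 2 \<le> t"
    if "simple_cycle E V (b # us @ a # vs)" "successively E (b # q @ [a])" "distinct q" "set q \<subseteq> V"
      "set q \<inter> set (b # us @ a # vs) = {}" for b us a vs q
  proof (cases "us @ q = []")
    case True
    \<comment> \<open>The detour gives no cycle here, and the remaining claim that \<open>t\<close>
      is at least 2 comes from the given cycle.\<close>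
    then show ?thesis using circ[OF that(1)] that(1) by (auto simp: simple_cycle_def)
  next
    case False
    from circ[OF simple_cycle_detour[OF sym that False]] show ?thesis by simp
  qed
  from *[OF assms] show "length us + length q + 2 \<le> t" .
  have "successively E (rev (b # q @ [a]))" using q(1) sym by (simp only: successively_rev_symp)
  then have "successively E (a # rev q @ [b])" by simp
  moreover have "simple_cycle E V (a # vs @ b # us)"
    using C simple_cycle_rotate[of E V "b # us" "a # vs"] by simp
  ultimately show "length vs + length q + 2 \<le> t"
    using *[of a vs b us "rev q"] q by auto
qed

text \<open>Sum of the two bounds of \<open>ear_length\<close>: the two arcs have
  \<open>length C - 2\<close> inner vertices together.\<close>

lemma ear_length_cycle:
  assumes C: "simple_cycle E V C" "a \<in> set C" "b \<in> set C" "a \<noteq> b"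
    and q: "successively E (b # q @ [a])" "distinct q" "set q \<subseteq> V" "set q \<inter> set C = {}"
  shows "2 * (length q + 1) + length C \<le> 2 * t"
proof -
  obtain r where r: "simple_cycle E V (b # r)" "set (b # r) = set C" "length (b # r) = length C"
    using simple_cycle_rotate_to[OF C(1,3)] .
  then have "a \<in> set r" using C by auto
  then obtain us vs where "r = us @ a # vs" by (auto dest: split_list)
  with r ear_length[of b us a vs q] q show ?thesis by auto
qed

text \<open>Both ears can only be as long as \<open>ear_length_cycle\<close> allows if \<open>a\<close> and \<open>d\<close> are the antipode
  of \<open>b\<close> on the cycle.\<close>

lemma two_ears_length:
  assumes C: "simple_cycle E V C" "a \<in> set C" "b \<in> set C" "d \<in> set C" "a \<noteq> b" "d \<noteq> b" "a \<noteq> d"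
    and q: "successively E (a # q @ [b])" "distinct q" "set q \<subseteq> V" "set q \<inter> set C = {}"
    and q': "successively E (b # q' @ [d])" "distinct q'" "set q' \<subseteq> V" "set q' \<inter> set C = {}"
  shows "length q + length q' + 2 + length C + 1 \<le> 2 * t"
proof -
  obtain r where r: "simple_cycle E V (b # r)" "set (b # r) = set C" "length (b # r) = length C"
    using simple_cycle_rotate_to[OF C(1,3)] .
  have "a \<in> set r" "d \<in> set r" using C r(2) by auto
  then obtain us vs us' vs' where uv: "r = us @ a # vs" and uv': "r = us' @ d # vs'"
    by (meson split_list)
  have "successively E (rev (a # q @ [b]))" using q(1) sym by (simp only: successively_rev_symp)
  then have rq: "successively E (b # rev q @ [a])" by simp
  have 1: "length us + length q + 2 \<le> t" "length vs + length q + 2 \<le> t"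
    using ear_length[of b us a vs "rev q"] rq q r uv by auto
  have 2: "length us' + length q' + 2 \<le> t" "length vs' + length q' + 2 \<le> t"
    using ear_length[of b us' d vs' q'] q' r uv' by auto
  have 3: "length us + length vs + 2 = length C" "length us' + length vs' + 2 = length C"
    using r(3) uv arg_cong[OF uv', of length] by auto
  \<comment> \<open>As \<open>a\<close> and \<open>d\<close> occupy different positions of
    \<open>r\<close>, at most one of them is its midpoint; the ear to the other one faces a longer
    arc, which gains the final 1.\<close>
  have "length us \<noteq> length us'"
    using uv uv' C(7) by (auto simp: append_eq_append_conv)
  with 1 2 3 show ?thesis by linarith
qed

text \<open>There are \<open>n\<close> pieces between consecutive visits. They are removed two at a
  time by \<open>two_ears_length\<close>. For odd \<open>n\<close> one piece is left to
  \<open>ear_length_cycle\<close>, whose bound on twice the length is larger by 1; if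
  \<open>length C\<close> is odd, parity removes this excess.\<close>

lemma path_length_by_visits:
  assumes C: "simple_cycle E V C"
    and p: "simple_path E V p" "hd p \<in> set C" "last p \<in> set C"
    and n: "length (filter (\<lambda>v. v \<in> set C) p) = Suc n"
  shows "2 * (length p - 1) \<le> n * (2 * t - length C - 1) + (if odd n \<and> even (length C) then 1 else 0)"
  using p n
proof (induction "length p" arbitrary: p n rule: less_induct)
  case less
  obtain a r where p: "p = a # r" using less.prems by (cases p) (auto simp: simple_path_def)
  have aC: "a \<in> set C" using less.prems p by simp
  have tC: "length C \<le> t" using circ C .
  show ?case
  proof (cases "r = []")
    case True
    then show ?thesis using p by simp
  next
    case False
    then have "\<exists>b\<in>set r. b \<in> set C" using less.prems(3) p last_in_set[of r] by auto
    then obtain q b r' where r: "r = q @ b # r'" "b \<in> set C" "\<forall>v\<in>set q. v \<notin> set C"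
      using split_list_first_prop[of r "\<lambda>w. w \<in> set C"] by blast
    have q: "successively E (a # q @ [b])" "distinct q" "set q \<subseteq> V" "set q \<inter> set C = {}" "a \<noteq> b"
      using less.prems(1) p r
      by (auto simp: simple_path_def successively_append_iff successively_Cons hd_append split: if_splits)
    have fq: "filter (\<lambda>v. v \<in> set C) q = []" using r(3) by (simp add: filter_empty_conv)
    show ?thesis
    proof (cases "r' = []")
      case True
      then have "n = 1" using less.prems(4) p r aC fq by simp
      moreover have "2 * (length q + 1) + length C \<le> 2 * t"
        using ear_length_cycle[OF C r(2) aC _ q(1-4)] q(5) by simp
      moreover have "2 * (length p - 1) = 2 * (length q + 1)" using p r True by simp
      moreover have "3 \<le> length C" using C by (simp add: simple_cycle_def)
      ultimately show ?thesis by (cases "even (length C)") (simp, presburger)+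
    next
      case False
      then have "\<exists>b\<in>set r'. b \<in> set C" using less.prems(3) p r last_in_set[of r'] by auto
      then obtain q' d r'' where r': "r' = q' @ d # r''" "d \<in> set C" "\<forall>v\<in>set q'. v \<notin> set C"
        using split_list_first_prop[of r' "\<lambda>w. w \<in> set C"] by blast
      have q': "successively E (b # q' @ [d])" "distinct q'" "set q' \<subseteq> V" "set q' \<inter> set C = {}"
          "d \<noteq> b" "a \<noteq> d"
        using less.prems(1) p r r'
        by (auto simp: simple_path_def successively_append_iff successively_Cons hd_append split: if_splits)
      have fq': "filter (\<lambda>v. v \<in> set C) q' = []" using r'(3) by (simp add: filter_empty_conv)
      have two: "length q + length q' + 2 + length C + 1 \<le> 2 * t"
        using two_ears_length[OF C aC r(2) r'(2) q(5) q'(5,6) q(1-4) q'(1-4)] .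
      have "simple_path E V (d # r'')"
        using less.prems(1) simple_path_suffix[of E V "a # q @ b # q'" "d # r''"] p r r' by simp
      moreover have "last (d # r'') \<in> set C" using less.prems(3) p r r' by simp
      moreover obtain m where m: "n = Suc (Suc m)" "length (filter (\<lambda>v. v \<in> set C) (d # r'')) = Suc m"
        using less.prems(4) p r r' aC fq fq' by auto
      ultimately have IH: "2 * (length (d # r'') - 1) \<le>
          m * (2 * t - length C - 1) + (if odd m \<and> even (length C) then 1 else 0)"
        using less.hyps[of "d # r''" m] p r r' by simp
      define k where "k = 2 * t - length C - 1"
      have "length q + length q' + 2 \<le> k" using two unfolding k_def by linarith
      moreover have "length p - 1 = length q + length q' + 2 + (length (d # r'') - 1)" using p r r' by simp
      ultimately have "2 * (length p - 1) \<le> 2 * k + 2 * (length (d # r'') - 1)" by linarith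
      then show ?thesis using IH unfolding k_def[symmetric] m(1) by simp
    qed
  qed
qed

text \<open>With \<open>d = t - c\<close>, the product is at most (c - 1)(2t - c - 1) = (t - 1)^2 -
  d^2. For even \<open>t\<close>, twice the target is (t - 1)^2 + (t - 1), which leaves room for the
  extra 1. For odd \<open>t\<close> it is (t - 1)^2, but the extra 1 occurs only for even
  \<open>c\<close>; then \<open>d\<close> is nonzero and d^2 absorbs it.\<close>

lemma visits_bound:
  fixes c n l :: nat
  assumes c: "3 \<le> c" "c \<le> t" and n: "n < c"
    and l: "2 * l \<le> n * (2 * t - c - 1) + (if odd n \<and> even c then 1 else 0)"
  shows "l \<le> (t div 2) * (t - 1)"
proof -
  obtain d where d: "t = c + d" using c(2) le_Suc_ex by blast
  obtain e where e: "c = Suc e" using c(1) by (cases c) auto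
  have k: "2 * t - c - 1 = e + 2 * d" using d e by simp
  have "n * (2 * t - c - 1) \<le> e * (e + 2 * d)" unfolding k using n e by (intro mult_right_mono) auto
  then have l': "2 * l \<le> e * (e + 2 * d) + (if even c then 1 else 0)" using l by (auto split: if_splits)
  have sq: "(t - 1) * (t - 1) = e * (e + 2 * d) + d * d" using d e by (simp add: algebra_simps)
  have "2 * l \<le> 2 * (t div 2) * (t - 1)"
  proof (cases "even t")
    case True
    then have "2 * (t div 2) * (t - 1) = (t - 1) * (t - 1) + (t - 1)"
      using c by (cases t) (auto simp: algebra_simps)
    then show ?thesis using l' sq c by (auto split: if_splits)
  next
    case False
    then have *: "2 * (t div 2) * (t - 1) = (t - 1) * (t - 1)"
      by (metis odd_two_times_div_two_nat)
    show ?thesis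
    proof (cases "even c")
      case True
      then have "d \<noteq> 0" using False d by (cases "d = 0") auto
      then have "1 \<le> d * d" by (cases d) auto
      have "2 * l \<le> e * (e + 2 * d) + 1" using l' True by simp
      also have "\<dots> \<le> e * (e + 2 * d) + d * d" using \<open>1 \<le> d * d\<close> by (rule add_left_mono)
      finally show ?thesis unfolding * sq .
    next
      case False
      then show ?thesis using l' sq * by auto
    qed
  qed
  then show ?thesis by simp
qed

lemma simple_path_length:
  assumes p: "simple_path E V p"
  shows "length p \<le> (t div 2) * (t - 1) + 1"
proof (cases "2 \<le> length p")
  case True
  then obtain C where C: "simple_cycle E V C" "hd p \<in> set C" "last p \<in> set C"
    using ex_cycle_through_ends p by blast
  let ?f = "filter (\<lambda>v. v \<in> set C) p"
  have "p \<noteq> []" using True by auto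
  then have "hd p \<in> set ?f" using C by auto
  then obtain n where n: "length ?f = Suc n" by (cases ?f) auto
  \<comment> \<open>The visits are distinct vertices of \<open>C\<close>, so the pieces between them
    number at most \<open>length C - 1\<close>.\<close>
  have "distinct ?f" using p by (simp add: simple_path_def)
  then have "length ?f = card (set ?f)" by (rule distinct_card[symmetric])
  also have "\<dots> \<le> card (set C)" by (intro card_mono) auto
  also have "\<dots> \<le> length C" by (rule card_length)
  finally have "n < length C" using n by simp
  moreover have "3 \<le> length C" using C by (simp add: simple_cycle_def)
  ultimately have "length p - 1 \<le> (t div 2) * (t - 1)"
    using visits_bound circ[OF C(1)] path_length_by_visits[OF C(1) p C(2,3) n] by blast
  then show ?thesis by simp
qed simp

end

section \<open>Path decompositions of graphs without long paths\<close>

text \<open>The interval condition on bags, stated without indices so that it passes easily through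
  appending and mapping. The block \<open>bs\<close> may be empty.\<close>

definition block_in :: "('b \<Rightarrow> bool) \<Rightarrow> 'b list \<Rightarrow> bool" where
  "block_in P xs \<longleftrightarrow> (\<exists>as bs cs. xs = as @ bs @ cs \<and>
     (\<forall>x\<in>set as \<union> set cs. \<not> P x) \<and> (\<forall>x\<in>set bs. P x))"

lemma block_in_all: "\<forall>x\<in>set xs. P x \<Longrightarrow> block_in P xs"
  unfolding block_in_def by (intro exI[of _ "[]"] exI[of _ xs]) simp

lemma block_in_none: "\<forall>x\<in>set xs. \<not> P x \<Longrightarrow> block_in P xs"
  unfolding block_in_def by (intro exI[of _ "[]"] exI[of _ xs]) simp

lemma block_in_append_left: "block_in P xs \<Longrightarrow> \<forall>y\<in>set ys. \<not> P y \<Longrightarrow> block_in P (xs @ ys)"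
  unfolding block_in_def by (elim exE, rename_tac as bs cs)
    (rule_tac x = as in exI, rule_tac x = bs in exI, rule_tac x = "cs @ ys" in exI, auto)

lemma block_in_append_right: "block_in P ys \<Longrightarrow> \<forall>x\<in>set xs. \<not> P x \<Longrightarrow> block_in P (xs @ ys)"
  unfolding block_in_def by (elim exE, rename_tac as bs cs)
    (rule_tac x = "xs @ as" in exI, rule_tac x = bs in exI, rule_tac x = cs in exI, auto)

lemma block_in_map: "block_in (\<lambda>x. P (f x)) xs \<Longrightarrow> block_in P (map f xs)"
  unfolding block_in_def by (elim exE, rename_tac as bs cs)
    (rule_tac x = "map f as" in exI, rule_tac x = "map f bs" in exI, rule_tac x = "map f cs" in exI, auto)

lemma block_in_interval:
  assumes "block_in P xs"
  shows "\<exists>a b. {i. i < length xs \<and> P (xs ! i)} = {a..b::nat}"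
proof -
  obtain as bs cs where xs: "xs = as @ bs @ cs" "\<forall>x\<in>set as \<union> set cs. \<not> P x" "\<forall>x\<in>set bs. P x"
    using assms unfolding block_in_def by blast
  have *: "{i. i < length xs \<and> P (xs ! i)} = {length as..<length as + length bs}"
  proof -
    have "P (xs ! i) \<longleftrightarrow> i < length as + length bs"
      if "i < length xs" "length as \<le> i" for i
    proof (cases "i < length as + length bs")
      case True
      then have "xs ! i = bs ! (i - length as)" "i - length as < length bs"
        using that xs(1) by (auto simp: nth_append)
      then show ?thesis using xs(3) True by simp
    next
      case False
      then have "xs ! i = cs ! (i - length as - length bs)" "i - length as - length bs < length cs"
        using that xs(1) by (auto simp: nth_append)
      then show ?thesis using xs(2) False by simp
    qed
    moreover have "\<not> P (xs ! i)" if "i < length as" for i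
      using that xs(1,2) by (simp add: nth_append)
    moreover have "length xs = length as + length bs + length cs" using xs(1) by simp
    ultimately have "i < length xs \<and> P (xs ! i) \<longleftrightarrow> length as \<le> i \<and> i < length as + length bs" for i
      by (cases "length as \<le> i") auto
    then show ?thesis by (simp only: atLeastLessThan_def atLeast_def lessThan_def Int_def mem_Collect_eq)
  qed
  show ?thesis
  proof (cases bs)
    case Nil
    \<comment> \<open>An empty block needs an empty closed interval of naturals, such as
      \<open>{1..0}\<close>.\<close>
    then show ?thesis unfolding * by (intro exI[of _ 1] exI[of _ 0]) simp
  next
    case (Cons b bs')
    then show ?thesis
      unfolding * by (intro exI[of _ "length as"] exI[of _ "length as + length bs'"]) auto
  qed
qed

text \<open>A path decomposition of the graph induced on \<open>S\<close>. The number
  \<open>k\<close> bounds the bag size, not the width, and so compares directly with the number of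
  vertices of a path.\<close>

definition bags_of :: "('a \<Rightarrow> 'a \<Rightarrow> bool) \<Rightarrow> 'a set \<Rightarrow> nat \<Rightarrow> 'a set list \<Rightarrow> bool" where
  "bags_of E S k Bs \<longleftrightarrow> Bs \<noteq> [] \<and> (\<forall>B\<in>set Bs. B \<subseteq> S \<and> card B \<le> k) \<and> S \<subseteq> \<Union> (set Bs) \<and>
     (\<forall>v. block_in (\<lambda>B. v \<in> B) Bs) \<and>
     (\<forall>u\<in>S. \<forall>v\<in>S. E u v \<longrightarrow> (\<exists>B\<in>set Bs. u \<in> B \<and> v \<in> B))"

lemma bags_ofD:
  assumes "bags_of E S k Bs"
  shows "Bs \<noteq> []" "B \<in> set Bs \<Longrightarrow> B \<subseteq> S" "B \<in> set Bs \<Longrightarrow> card B \<le> k"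
    "v \<in> S \<Longrightarrow> \<exists>B\<in>set Bs. v \<in> B" "block_in (\<lambda>B. v \<in> B) Bs"
    "\<lbrakk>u \<in> S; v \<in> S; E u v\<rbrakk> \<Longrightarrow> \<exists>B\<in>set Bs. u \<in> B \<and> v \<in> B"
  using assms unfolding bags_of_def by blast+

lemma bags_of_union:
  assumes B: "bags_of E S k Bs" and B': "bags_of E T k Bs'" and disj: "S \<inter> T = {}"
    and sep: "\<And>u v. \<lbrakk>u \<in> S; v \<in> T\<rbrakk> \<Longrightarrow> \<not> E u v \<and> \<not> E v u"
  shows "bags_of E (S \<union> T) k (Bs @ Bs')"
  unfolding bags_of_def
proof (intro conjI ballI allI impI)
  show "Bs @ Bs' \<noteq> []" using bags_ofD(1)[OF B] by simp
  show "A \<subseteq> S \<union> T" "card A \<le> k" if "A \<in> set (Bs @ Bs')" for A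
    using that bags_ofD(2,3)[OF B] bags_ofD(2,3)[OF B'] by auto
  show "S \<union> T \<subseteq> \<Union> (set (Bs @ Bs'))"
    using bags_ofD(4)[OF B] bags_ofD(4)[OF B'] by auto
  show "block_in (\<lambda>B. v \<in> B) (Bs @ Bs')" for v
  proof (cases "v \<in> S")
    case True
    then have "\<forall>B\<in>set Bs'. v \<notin> B" using bags_ofD(2)[OF B'] disj by blast
    with bags_ofD(5)[OF B] show ?thesis by (rule block_in_append_left)
  next
    case False
    then have "\<forall>B\<in>set Bs. v \<notin> B" using bags_ofD(2)[OF B] by blast
    with bags_ofD(5)[OF B'] show ?thesis by (rule block_in_append_right)
  qed
  fix u v assume uv: "u \<in> S \<union> T" "v \<in> S \<union> T" "E u v"
  then consider "u \<in> S" "v \<in> S" | "u \<in> T" "v \<in> T" using sep by blast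
  then show "\<exists>A\<in>set (Bs @ Bs'). u \<in> A \<and> v \<in> A"
  proof cases
    case 1
    from bags_ofD(6)[OF B this uv(3)] show ?thesis by auto
  next
    case 2
    from bags_ofD(6)[OF B' this uv(3)] show ?thesis by auto
  qed
qed

text \<open>With \<open>r\<close> in every bag, all edges at \<open>r\<close> are covered and the
  block of \<open>r\<close> is the whole list.\<close>

lemma bags_of_insert:
  assumes B: "bags_of E S k Bs" and "finite S"
  shows "bags_of E (insert r S) (Suc k) (map (insert r) Bs)"
  unfolding bags_of_def
proof (intro conjI ballI allI impI)
  show "map (insert r) Bs \<noteq> []" using bags_ofD(1)[OF B] by simp
  show "A \<subseteq> insert r S" "card A \<le> Suc k" if A: "A \<in> set (map (insert r) Bs)" for A
  proof -
    obtain A' where "A = insert r A'" "A' \<in> set Bs" using A by auto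
    moreover from this have "finite A'" using bags_ofD(2)[OF B] \<open>finite S\<close> finite_subset by blast
    ultimately show "A \<subseteq> insert r S" "card A \<le> Suc k"
      using bags_ofD(2,3)[OF B, of A'] by (auto simp: card_insert_if)
  qed
  show "insert r S \<subseteq> \<Union> (set (map (insert r) Bs))"
    using bags_ofD(1,4)[OF B] by (cases Bs) auto
  show "block_in (\<lambda>B. v \<in> B) (map (insert r) Bs)" for v
  proof (cases "v = r")
    case True
    then show ?thesis by (intro block_in_all) auto
  next
    case False
    then show ?thesis using bags_ofD(5)[OF B, of v] by (intro block_in_map) simp
  qed
  fix u v assume uv: "u \<in> insert r S" "v \<in> insert r S" "E u v"
  have "\<exists>A\<in>set Bs. u \<in> insert r A \<and> v \<in> insert r A"
  proof (cases "u \<in> S \<and> v \<in> S")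
    case True
    then show ?thesis using bags_ofD(6)[OF B _ _ uv(3)] by blast
  next
    case False
    then consider "u = r" "v = r" | "u = r" "v \<in> S" | "v = r" "u \<in> S" using uv by blast
    then show ?thesis
    proof cases
      case 1
      then show ?thesis using bags_ofD(1)[OF B] by (cases Bs) auto
    qed (use bags_ofD(4)[OF B] in blast)+
  qed
  then show "\<exists>A\<in>set (map (insert r) Bs). u \<in> A \<and> v \<in> A" by auto
qed

text \<open>The bags are the root-to-leaf paths of a depth-first search forest, in the order in which
  the leaves are visited. \<open>R\<close> contains the admissible roots.\<close>

lemma ex_bags_of:
  assumes "finite S" "symp E"
    and "\<And>u. u \<in> S \<Longrightarrow> \<exists>p. simple_path E S p \<and> hd p \<in> R \<and> last p = u"
    and "\<And>p. \<lbrakk>simple_path E S p; hd p \<in> R\<rbrakk> \<Longrightarrow> length p \<le> k"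
  shows "\<exists>Bs. bags_of E S k Bs"
  using assms
proof (induction "card S" arbitrary: S R k rule: less_induct)
  case less
  show ?case
  proof (cases "S = {}")
    case True
    \<comment> \<open>One empty bag is used instead of none, so that a root added later by
      \<open>bags_of_insert\<close> finds a bag to enter.\<close>
    have "block_in (\<lambda>B. v \<in> B) [{}]" for v :: 'a by (rule block_in_none) simp
    then have "bags_of E S k [{}]" using True by (simp add: bags_of_def)
    then show ?thesis ..
  next
    case False
    then obtain u0 where "u0 \<in> S" by auto
    then obtain p0 where p0: "simple_path E S p0" "hd p0 \<in> R" using less.prems(3) by metis
    define r where "r = hd p0"
    have "p0 \<noteq> []" "set p0 \<subseteq> S" using p0(1) by (simp_all add: simple_path_def)
    then have r: "r \<in> R" "r \<in> S" using p0(2) hd_in_set[of p0] by (auto simp only: r_def)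
    have rp: "simple_path E S [r]" using r(2) by (simp add: simple_path_def)
    \<comment> \<open>\<open>K\<close> is the component of \<open>r\<close> in \<open>S\<close>. The
      recursion treats \<open>K - {r}\<close>, with the neighbours of \<open>r\<close> as roots and
      one vertex less per path, and separately \<open>S - K\<close>, with the old roots and the old
      bound.\<close>
    define K where "K = {u. \<exists>p. simple_path E S p \<and> hd p = r \<and> last p = u}"
    have KS: "K \<subseteq> S" unfolding K_def by (auto simp: simple_path_def)
    have rK: "r \<in> K" unfolding K_def using rp by (auto intro!: exI[of _ "[r]"])
    have closed: "w \<in> K" if "u \<in> K" "E u w" "w \<in> S" for u w
    proof -
      obtain p where p: "simple_path E S p" "hd p = r" "last p = u"
        using \<open>u \<in> K\<close> unfolding K_def by blast
      then show ?thesis using simple_path_extend[of E S p w] that unfolding K_def by simp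
    qed
    have fK: "finite K" using KS less.prems(1) finite_subset by blast
    obtain k' where k: "k = Suc k'" using less.prems(4)[OF rp] r by (cases k) auto
    define R' where "R' = {w. E r w}"
    have "\<exists>Bs. bags_of E (K - {r}) k' Bs"
    proof (rule less.hyps)
      show "card (K - {r}) < card S"
        using KS rK less.prems(1) by (intro psubset_card_mono) auto
      show "finite (K - {r})" using fK by simp
      fix u assume u: "u \<in> K - {r}"
      then obtain p where p: "simple_path E S p" "hd p = r" "last p = u" unfolding K_def by blast
      then obtain q where q: "p = r # q" "q \<noteq> []" using u by (cases p) (auto simp: simple_path_def split: if_splits)
      have "set p \<subseteq> K"
      proof
        fix x assume "x \<in> set p"
        then obtain xs ys where "p = xs @ x # ys" by (auto dest: split_list)
        then have "simple_path E S (xs @ [x])" "hd (xs @ [x]) = r"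
          using p simple_path_prefix[of E S "xs @ [x]" ys] by (auto simp: hd_append)
        then show "x \<in> K" unfolding K_def by (auto intro!: exI[of _ "xs @ [x]"])
      qed
      then have "simple_path E (K - {r}) q" "hd q \<in> R'" "last q = u"
        using p q unfolding R'_def by (auto simp: simple_path_def successively_Cons)
      then show "\<exists>p. simple_path E (K - {r}) p \<and> hd p \<in> R' \<and> last p = u" by blast
    next
      fix p assume p: "simple_path E (K - {r}) p" "hd p \<in> R'"
      \<comment> \<open>Prepending \<open>r\<close> gives a path from an admissible root, so
        \<open>p\<close> itself is shorter than \<open>k\<close>.\<close>
      then have "simple_path E S (r # p)"
        using KS r unfolding R'_def by (auto simp: simple_path_def successively_Cons)
      then have "length (r # p) \<le> k" using r by (intro less.prems(4)) auto
      then show "length p \<le> k'" using k by simp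
    qed (rule less.prems(2))
    then obtain Bs where "bags_of E (K - {r}) k' Bs" ..
    then have B: "bags_of E (insert r (K - {r})) k (map (insert r) Bs)"
      unfolding k using fK by (intro bags_of_insert) auto
    have "\<exists>Bs. bags_of E (S - K) k Bs"
    proof (rule less.hyps)
      show "card (S - K) < card S"
        using rK r less.prems(1) by (intro psubset_card_mono) auto
      show "finite (S - K)" using less.prems(1) by simp
      fix u assume u: "u \<in> S - K"
      then obtain p where p: "simple_path E S p" "hd p \<in> R" "last p = u" using less.prems(3) by blast
      \<comment> \<open>After its last vertex in \<open>K\<close> the path would step to a vertex of
        \<open>S\<close> outside \<open>K\<close>, although \<open>K\<close> is closed under edges
        within \<open>S\<close>.\<close>
      have "set p \<inter> K = {}"
      proof (rule ccontr)
        assume "set p \<inter> K \<noteq> {}"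
        then obtain xs x ys where x: "p = xs @ x # ys" "x \<in> K" "\<forall>y\<in>set ys. y \<notin> K"
          using split_list_last_prop[of p "\<lambda>x. x \<in> K"] by blast
        then have "ys \<noteq> []" using p u by auto
        then have "E x (hd ys)" "hd ys \<in> S" "hd ys \<in> set ys"
          using p(1) x(1) by (auto simp: simple_path_def successively_append_iff successively_Cons)
        then show False using closed x by blast
      qed
      then show "\<exists>p. simple_path E (S - K) p \<and> hd p \<in> R \<and> last p = u"
        using p by (intro exI[of _ p]) (auto simp: simple_path_def)
    next
      fix p assume "simple_path E (S - K) p" "hd p \<in> R"
      then show "length p \<le> k" using less.prems(4) simple_path_mono[of E "S - K" p S] by blast
    qed (rule less.prems(2))
    then obtain Bs' where B': "bags_of E (S - K) k Bs'" ..
    have "bags_of E (insert r (K - {r}) \<union> (S - K)) k (map (insert r) Bs @ Bs')"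
    proof (rule bags_of_union[OF B B'])
      show "\<not> E u v \<and> \<not> E v u" if "u \<in> insert r (K - {r})" "v \<in> S - K" for u v
      proof -
        have "u \<in> K" "v \<in> S" "v \<notin> K" using that rK by auto
        then have "\<not> E u v" using closed by blast
        then show ?thesis using sympD[OF less.prems(2), of v u] by blast
      qed
    qed (use rK in auto)
    moreover have "insert r (K - {r}) \<union> (S - K) = S" using rK KS by auto
    ultimately show ?thesis by auto
  qed
qed

section \<open>Transfer to digraphs\<close>

text \<open>The vertex list is lifted to a closed walk of arcs, whose length belongs to
  \<open>cycle_lengths G\<close>. Finiteness of that set makes its \<open>Max\<close> an upper
  bound.\<close>

lemma (in graph) simple_cycle_length_le_circumference:
  assumes "simple_cycle (dominates G) (verts G) p"
  shows "length p \<le> circumference G"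
proof -
  have walk: "\<exists>es. set es \<subseteq> arcs G \<and> cas u es (last (u # ps)) \<and> awalk_verts u es = u # ps"
    if "successively (dominates G) (u # ps)" for u ps
    using that
  proof (induction ps arbitrary: u)
    case Nil
    then show ?case by (intro exI[of _ "[]"]) simp
  next
    case (Cons v ps)
    then obtain es where "set es \<subseteq> arcs G" "cas v es (last (v # ps))" "awalk_verts v es = v # ps" by auto
    moreover obtain e where "e \<in> arcs G" "tail G e = u" "head G e = v" using Cons.prems by auto
    ultimately show ?case by (intro exI[of _ "e # es"]) auto
  qed
  obtain u ps where p: "p = u # ps" using assms by (cases p) (auto simp: simple_cycle_def)
  obtain es where es: "set es \<subseteq> arcs G" "cas u es u" "awalk_verts u es = u # ps @ [u]"
    using walk[of u "ps @ [u]"] assms p by (auto simp: simple_cycle_def)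
  have len: "length es = length p" using length_awalk_verts[of u es] es(3) p by simp
  have "cycle es"
    using es assms p len unfolding cycle_def awalk_def
    by (intro exI[of _ u]) (auto simp: simple_cycle_def)
  then have "length p \<in> cycle_lengths G"
    using assms len unfolding cycle_lengths_def simple_cycle_def by force
  moreover have "finite (cycle_lengths G)"
  proof (rule finite_subset)
    show "cycle_lengths G \<subseteq> {..card (verts G)}"
    proof
      fix l assume "l \<in> cycle_lengths G"
      then obtain es u where es: "awalk u es u" "distinct (tl (awalk_verts u es))" "l = length es"
        by (auto simp: cycle_lengths_def cycle_def)
      \<comment> \<open>Dropping the repeated start leaves as many distinct vertices as the cycle
        has arcs.\<close>
      have "set (tl (awalk_verts u es)) \<subseteq> verts G"
        using awalk_verts_in_verts[of u es] es(1) list.set_sel(2)[of "awalk_verts u es"]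
        by (auto simp: awalk_def)
      then have "card (set (tl (awalk_verts u es))) \<le> card (verts G)" by (intro card_mono) auto
      then show "l \<in> {..card (verts G)}"
        using es(2,3) by (simp add: distinct_card length_awalk_verts)
    qed
  qed simp
  ultimately show ?thesis unfolding circumference_def by auto
qed

text \<open>In a symmetric digraph connectedness yields directed reachability, along which
  \<open>simple_path_extend\<close> builds the path.\<close>

lemma (in graph) connected_induce_subgraph_path:
  assumes "Digraph_Component.connected (G \<restriction> S)" "S \<subseteq> verts G" "u \<in> S" "v \<in> S"
  shows "\<exists>p. simple_path (dominates G) S p \<and> hd p = u \<and> last p = v"
proof -
  have "symmetric (G \<restriction> S)"
    using induced_graph_imp_symmetric[OF sym_arcs] assms(2) by blast
  then have "strongly_connected (G \<restriction> S)"
    using assms(1) wf_digraph.symmetric_connected_imp_strongly_connected[OF wellformed_induce_subgraph] by blast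
  then have "(u, v) \<in> rtrancl_on S (arcs_ends (G \<restriction> S))"
    using assms(3,4) by (auto simp: strongly_connected_def reachable_def)
  then show ?thesis
  proof (induction rule: rtrancl_on_induct)
    case base
    then show ?case by (intro exI[of _ "[u]"]) (simp add: simple_path_def)
  next
    case (step y z)
    then show ?case using simple_path_extend[of "dominates G" S _ z] dominates_induce_subgraphD by metis
  qed
qed

theorem theorem1:
  fixes t :: nat and G :: "('a, 'b) pre_digraph"
  assumes "graph G"
    and "k_connected 2 G"
    and "circumference G = t"
  shows "int (pathwidth G) \<le> \<lfloor>real t / 2\<rfloor> * (int t - 1)"
proof -
  interpret graph G by fact
  have card: "3 \<le> card (verts G)" using assms(2) by (simp add: k_connected_def)
  have conn: "Digraph_Component.connected (G \<restriction> (verts G - {x}))" if "x \<in> verts G" for x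
    using assms(2) that by (auto simp: k_connected_def)
  interpret two_connected_circumference "dominates G" "verts G" t
  proof
    show "symp (dominates G)"
      using sym_arcs by (auto simp: symmetric_def sym_def intro: sympI)
    show "\<not> dominates G x x" for x using adj_not_same by blast
    show "\<exists>p. simple_path (dominates G) (verts G - {x}) p \<and> hd p = u \<and> last p = v"
      if "x \<in> verts G" "u \<in> verts G - {x}" "v \<in> verts G - {x}" for x u v
      using connected_induce_subgraph_path[of "verts G - {x}" u v] conn[of x] that by auto
    show "length C \<le> t" if "simple_cycle (dominates G) (verts G) C" for C
      using simple_cycle_length_le_circumference[OF that] assms(3) by simp
  qed (use card in auto)
  define k where "k = (t div 2) * (t - 1)"
  \<comment> \<open>Every vertex may serve as a root, since the length bound holds for all paths. A
    path with \<open>k\<close> edges has \<open>k + 1\<close> vertices.\<close>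
  obtain Bs where Bs: "bags_of (dominates G) (verts G) (k + 1) Bs"
  proof -
    have "\<exists>p. simple_path (dominates G) (verts G) p \<and> hd p \<in> verts G \<and> last p = u"
      if "u \<in> verts G" for u
      using that by (intro exI[of _ "[u]"]) (simp add: simple_path_def)
    then show ?thesis
      using that ex_bags_of[OF finite_verts sym, of "verts G" "k + 1"] simple_path_length
      unfolding k_def by blast
  qed
  have pd: "path_decomposition G Bs"
    unfolding path_decomposition_def
  proof (intro conjI ballI)
    show "Bs \<noteq> []" "\<And>B. B \<in> set Bs \<Longrightarrow> B \<subseteq> verts G"
      "\<And>v. v \<in> verts G \<Longrightarrow> \<exists>B\<in>set Bs. v \<in> B"
      using Bs by (auto simp: bags_of_def)
    show "\<exists>a b. {i. i < length Bs \<and> v \<in> Bs ! i} = {a..b}" for v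
      using Bs block_in_interval[of "\<lambda>B. v \<in> B" Bs] by (auto simp: bags_of_def)
    show "case e of (u, v) \<Rightarrow> \<exists>B\<in>set Bs. u \<in> B \<and> v \<in> B" if "e \<in> arcs_ends G" for e
      using Bs that adj_in_verts by (cases e) (auto simp: bags_of_def)
  qed
  have "width Bs \<le> k"
  proof -
    have "Max (card ` set Bs) \<le> k + 1"
      using Bs by (intro Max.boundedI) (auto simp: bags_of_def)
    then show ?thesis by (simp add: width_def)
  qed
  moreover have "pathwidth G \<le> width Bs"
    unfolding pathwidth_def by (rule Least_le) (use pd in blast)
  ultimately have "int (pathwidth G) \<le> int k" by simp
  also have "int k = \<lfloor>real t / 2\<rfloor> * (int t - 1)"
  proof (cases t)
    \<comment> \<open>The truncated \<open>t - 1\<close> differs from \<open>int t - 1\<close> here,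
      but the other factor is 0.\<close>
    case 0
    then show ?thesis by (simp add: k_def)
  next
    case (Suc s)
    have "\<lfloor>real t / 2\<rfloor> = int (t div 2)" using floor_divide_of_nat_eq[of t 2] by simp
    then show ?thesis using Suc by (simp add: k_def)
  qed
  finally show ?thesis .
qed

end
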